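(* Let $0<z<\frac12$ and $\Delta>0$. Let $\tau=\frac{i\varepsilon}{2\pi}$ where $\varepsilon=x+iy$ with $x>0$, $y\in\mathbb{R}$ and $|y|\leq \Delta x$. Then \[ A_1(z,\tau;2\tau)\to 0\quad\text{and}\quad A_1(-z,\tau;2\tau)\to 0 \] as $\varepsilon\to 0$ within this region.
   Context: For $u,v\in\mathbb{C}$, $\sigma$ in the upper half-plane and an integer $\ell\geq1$, the level-$\ell$ Appell function is \[ A_\ell(u,v;\sigma):=e^{\pi i\ell u}\sum_{n\in\mathbb{Z}}\frac{(-1)^{\ell n}\,e^{\pi i \ell n(n+1)\sigma}\,e^{2\pi i n v}}{1-e^{2\pi i u}e^{2\pi i n\sigma}}. \] In particular $A_1(\pm z,\tau;2\tau)=e^{\pm\pi i z}\sum_{n\in\mathbb{Z}}\frac{(-1)^n e^{2\pi i n(n+1)\tau}e^{2\pi i n\tau}}{1-e^{\pm 2\pi i z}e^{4\pi i n\tau}}$. *)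

theory Defs
  imports "HOL-Analysis.Analysis"
begin

text \<open>
  For \<open>Im \<sigma> > 0\<close>, \<open>l \<ge> 1\<close> and \<open>u\<close> outside the lattice \<open>\<int> + \<int> \<sigma>\<close> the series converges
  absolutely, so the unconditional sum \<^const>\<open>infsum\<close> is its value; elsewhere the definition
  carries no meaning.
\<close>

definition appell :: "nat \<Rightarrow> complex \<Rightarrow> complex \<Rightarrow> complex \<Rightarrow> complex" where
  "appell l u v \<sigma> =
     exp (of_real pi * \<i> * of_nat l * u) *
     (\<Sum>\<^sub>\<infinity>n\<in>(UNIV :: int set).
        ((-1) powi (int l * n) * exp (of_real pi * \<i> * of_nat l * of_int n * (of_int n + 1) * \<sigma>)
           * exp (2 * of_real pi * \<i> * of_int n * v))
        / (1 - exp (2 * of_real pi * \<i> * u) * exp (2 * of_real pi * \<i> * of_int n * \<sigma>)))"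

end

theory Submission
  imports Defs
begin

text \<open>
  With \<open>w = exp (2 \<pi> \<i> u)\<close> and the square-completing shift \<open>n \<mapsto> n - 1\<close> the Appell series becomes, up to a bounded
  factor, the alternating sum of \<open>a n = g n * h n\<close>, where \<open>g n = exp (- \<epsilon> n\<^sup>2)\<close> and
  \<open>h n = 1 / (1 - w exp (- 2 (n - 1) \<epsilon>))\<close>. Four times this sum is the alternating sum of the
  second differences \<open>2 a n - a (n + 1) - a (n - 1)\<close>, each of which tends to 0 with \<open>\<epsilon>\<close>. In the
  sector \<open>exp (- 2 n \<epsilon>)\<close> can only have an argument far from 0 if its modulus is far from 1, so \<open>h\<close> is
  bounded uniformly in \<open>n\<close> and \<open>\<epsilon>\<close>, and \<open>h (n + 1) - h n = O(\<bar>\<epsilon>\<bar>)\<close>. Together with the decay of \<open>g\<close> this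
  bounds the second differences by a multiple of \<open>1 / (1 + n\<^sup>2)\<close> uniformly in \<open>\<epsilon>\<close>, and the limit may
  be taken termwise. First differences would only give the non-summable bound \<open>1 / \<bar>n\<bar>\<close>.
\<close>

section \<open>Dominated convergence and a summable majorant\<close>

text \<open>By the Weierstrass M-test the finite partial sums converge uniformly on the set
  \<open>Y\<close> of points where the majorant is valid. The filter eventually lies in
  \<open>Y\<close>, so limit and sum may be interchanged.\<close>

lemma tendsto_infsum_dominated:
  fixes f :: "'a \<Rightarrow> 'b \<Rightarrow> 'c :: banach" and M :: "'a \<Rightarrow> real"
  assumes lim: "\<And>k. k \<in> A \<Longrightarrow> (f k \<longlongrightarrow> 0) F"
    and bound: "\<forall>\<^sub>F x in F. \<forall>k\<in>A. norm (f k x) \<le> M k"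
    and "M summable_on A"
  shows "((\<lambda>x. \<Sum>\<^sub>\<infinity>k\<in>A. f k x) \<longlongrightarrow> 0) F"
proof (rule swap_uniform_limit')
  define Y where "Y = {x. \<forall>k\<in>A. norm (f k x) \<le> M k}"
  show "uniform_limit Y (\<lambda>X y. \<Sum>x\<in>X. f x y) (\<lambda>y. \<Sum>\<^sub>\<infinity>x\<in>A. f x y) (finite_subsets_at_top A)"
    by (rule Weierstrass_m_test_general) (use assms in \<open>auto simp: Y_def\<close>)
  show "\<forall>\<^sub>F x in F. x \<in> Y"
    using bound by (simp add: Y_def)
  show "\<forall>\<^sub>F X in finite_subsets_at_top A. ((\<lambda>y. \<Sum>x\<in>X. f x y) \<longlongrightarrow> 0) F"
    by (intro eventually_finite_subsets_at_top_weakI tendsto_null_sum) (use lim in auto)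
qed auto

text \<open>The shift \<open>k\<close> serves the majorant of a second difference at n, whose
  weights are centred at the index n and at its two neighbours.\<close>

lemma summable_on_inverse_one_plus_square:
  "(\<lambda>n::int. 1 / (1 + (real_of_int (n + k))\<^sup>2)) summable_on UNIV"
proof -
  let ?f = "\<lambda>n::int. 1 / (1 + (real_of_int n)\<^sup>2)"
  have "summable (\<lambda>n. 1 / real n ^ 2)"
    using inverse_power_summable[of 2, where ?'a = real] by (simp add: field_simps)
  then have "summable (\<lambda>n. 1 / (1 + (real n)\<^sup>2))"
    by (rule summable_comparison_test_ev[rotated])
      (auto intro!: eventually_mono[OF eventually_gt_at_top[of 0]] frac_le)
  then have nat: "(\<lambda>n. 1 / (1 + (real n)\<^sup>2)) summable_on UNIV"
    by (intro norm_summable_imp_summable_on) simp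
  have "?f summable_on {0..}"
    by (rule summable_on_reindex_bij_witness[of UNIV nat int, THEN iffD1, OF _ _ _ _ _ nat]) auto
  moreover have "?f summable_on {..0}"
    by (rule summable_on_reindex_bij_witness
          [of UNIV "\<lambda>n. nat (- n)" "\<lambda>n. - int n", THEN iffD1, OF _ _ _ _ _ nat]) auto
  ultimately have "?f summable_on ({0..} \<union> {..0})"
    by (rule summable_on_union)
  moreover have "{0..} \<union> {..0} = (UNIV :: int set)"
    by auto
  ultimately have "?f summable_on UNIV"
    by simp
  then show ?thesis
    by (rule summable_on_reindex_bij_witness
          [of UNIV "\<lambda>n. n - k" "\<lambda>n. n + k", THEN iffD2, rotated -1]) auto
qed

section \<open>Gaussian estimates uniform in \<epsilon>\<close>

text \<open>Trades one factor x, gained from a difference of size O(x), for a summable weight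
  independent of x: x (1 + t^2) is at most 2 + x t^2, hence at most 2 exp (x t^2).\<close>

lemma gaussian_weight_bound:
  fixes x t :: real
  assumes "0 < x" "x \<le> 1"
  shows "x * exp (- x * t\<^sup>2) \<le> 2 / (1 + t\<^sup>2)"
proof -
  have "0 \<le> x * t\<^sup>2"
    using assms by simp
  have "x * (1 + t\<^sup>2) \<le> 1 + (1 + x * t\<^sup>2)"
    using assms by (simp add: algebra_simps)
  also have "\<dots> \<le> 2 * exp (x * t\<^sup>2)"
    using exp_ge_add_one_self[of "x * t\<^sup>2"] \<open>0 \<le> x * t\<^sup>2\<close> by linarith
  finally have "x * (1 + t\<^sup>2) * exp (- x * t\<^sup>2) \<le> 2 * exp (x * t\<^sup>2) * exp (- x * t\<^sup>2)"
    by (intro mult_right_mono) auto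
  then have "x * exp (- x * t\<^sup>2) * (1 + t\<^sup>2) \<le> 2"
    by (simp add: exp_minus algebra_simps)
  moreover have "1 + t\<^sup>2 > 0" by (simp add: add_pos_nonneg)
  ultimately show ?thesis
    by (simp add: pos_le_divide_eq)
qed

text \<open>The analogue for quantities of size x^2 t^2. Only half of the Gaussian exponent is spent
  here; the other half is reserved for the factor \<open>exp (6 * x * \<bar>t\<bar>)\<close> that
  arises in the second difference.\<close>

lemma gaussian_moment_bound:
  fixes x t :: real
  assumes "0 < x" "x \<le> 1"
  shows "x\<^sup>2 * t\<^sup>2 * exp (- x * t\<^sup>2 / 2) \<le> 10 / (1 + t\<^sup>2)"
proof -
  define s where "s = x * t\<^sup>2"
  have s: "s \<ge> 0" using assms by (simp add: s_def)
  have "x\<^sup>2 * t\<^sup>2 * (1 + t\<^sup>2) = x * s + s\<^sup>2"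
    by (simp add: s_def power2_eq_square algebra_simps)
  also have "\<dots> \<le> s + s\<^sup>2"
    using assms s by (simp add: mult_left_le_one_le)
  \<comment> \<open>The factor 10 makes the coefficient of s^2 equal to 10/8, which exceeds
    1.\<close>
  also have "\<dots> \<le> 10 * (1 + s / 2 + (s / 2)\<^sup>2 / 2)"
    using s by (simp add: power_divide field_simps)
  also have "\<dots> \<le> 10 * exp (s / 2)"
    using exp_lower_Taylor_quadratic[of "s / 2"] s by simp
  finally have "x\<^sup>2 * t\<^sup>2 * (1 + t\<^sup>2) * exp (- s / 2) \<le> 10 * exp (s / 2) * exp (- s / 2)"
    by (intro mult_right_mono) auto
  then have "x\<^sup>2 * t\<^sup>2 * exp (- s / 2) * (1 + t\<^sup>2) \<le> 10"
    by (simp add: exp_minus algebra_simps)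
  moreover have "1 + t\<^sup>2 > 0" by (simp add: add_pos_nonneg)
  ultimately show ?thesis
    by (simp add: pos_le_divide_eq s_def)
qed

text \<open>This is the Taylor remainder of order zero. The growth factor involves Re u alone, so
  the exponents below depend on Re \<epsilon> and not on \<Delta>.\<close>

lemma norm_exp_minus_one_le:
  fixes u :: complex
  shows "norm (exp u - 1) \<le> exp \<bar>Re u\<bar> * norm u"
  using Taylor_exp[of u 0] by simp

text \<open>The sector condition enters the size estimates here: errors of order |\<epsilon>| become
  errors of order Re \<epsilon>, which is the decay rate of the Gaussian.\<close>

lemma norm_le_sector:
  assumes "Re \<epsilon> > 0" "\<bar>Im \<epsilon>\<bar> \<le> \<Delta> * Re \<epsilon>"
  shows "norm \<epsilon> \<le> (1 + \<Delta>) * Re \<epsilon>"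
  using cmod_le[of \<epsilon>] assms by (simp add: algebra_simps)

text \<open>Once the central Gaussian is factored out, the neighbours contribute exp (2u) + exp
  (-2u) with u = \<epsilon> t, which is 2 plus the square of exp (-u) - exp u. This separates a part
  of order \<epsilon> from a part of order (\<epsilon> t)^2, up to exponential factors.\<close>

lemma gaussian_second_difference:
  fixes \<epsilon> t :: complex
  shows "2 * exp (- \<epsilon> * t\<^sup>2) - exp (- \<epsilon> * (t + 1)\<^sup>2) - exp (- \<epsilon> * (t - 1)\<^sup>2)
       = exp (- \<epsilon> * t\<^sup>2) *
           (2 * (1 - exp (- \<epsilon>)) - exp (- \<epsilon>) * (exp (- (\<epsilon> * t)) * (1 - exp (2 * (\<epsilon> * t))))\<^sup>2)"
proof -
  have "exp (- \<epsilon> * (t + 1)\<^sup>2) = exp (- \<epsilon> * t\<^sup>2) * exp (- \<epsilon>) * exp (- 2 * (\<epsilon> * t))"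
    and "exp (- \<epsilon> * (t - 1)\<^sup>2) = exp (- \<epsilon> * t\<^sup>2) * exp (- \<epsilon>) * exp (2 * (\<epsilon> * t))"
    by (simp_all add: power2_eq_square algebra_simps flip: exp_add)
  moreover have "(exp (- (\<epsilon> * t)) * (1 - exp (2 * (\<epsilon> * t))))\<^sup>2 =
      exp (- 2 * (\<epsilon> * t)) - 2 + exp (2 * (\<epsilon> * t))"
    by (simp add: power2_eq_square algebra_simps mult_exp_exp)
  ultimately show ?thesis
    by (simp only:) (simp add: algebra_simps)
qed

text \<open>The part of order \<epsilon> is handled by \<open>gaussian_weight_bound\<close> and the
  squared part by \<open>gaussian_moment_bound\<close>, with x = Re \<epsilon>.\<close>

lemma gaussian_second_difference_bound:
  fixes \<epsilon> :: complex and t :: real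
  assumes "Re \<epsilon> > 0" "\<bar>Im \<epsilon>\<bar> \<le> \<Delta> * Re \<epsilon>" "norm \<epsilon> \<le> 1" "\<Delta> > 0"
  defines "C \<equiv> 4 * exp 1 * (1 + \<Delta>) + 40 * exp 18 * (1 + \<Delta>)\<^sup>2"
  shows "norm (2 * exp (- \<epsilon> * (of_real t)\<^sup>2) - exp (- \<epsilon> * (of_real t + 1)\<^sup>2)
           - exp (- \<epsilon> * (of_real t - 1)\<^sup>2)) \<le> C / (1 + t\<^sup>2)"
proof -
  define x where "x = Re \<epsilon>"
  have x: "0 < x" "x \<le> 1" 
    using assms complex_Re_le_cmod[of \<epsilon>] by (auto simp: x_def)
  have nx: "norm \<epsilon> \<le> (1 + \<Delta>) * x"
    using norm_le_sector[OF assms(1,2)] by (simp add: x_def)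
  have g: "norm (exp (- \<epsilon> * (of_real t)\<^sup>2)) = exp (- x * t\<^sup>2)"
    by (simp add: x_def norm_exp_eq_Re flip: of_real_power)
  have "norm (1 - exp (- \<epsilon>)) \<le> exp x * norm \<epsilon>"
    using norm_exp_minus_one_le[of "- \<epsilon>"] x by (simp add: x_def norm_minus_commute)
  also have "\<dots> \<le> exp 1 * ((1 + \<Delta>) * x)"
    using nx x by (intro mult_mono) auto
  finally have one: "norm (2 * (1 - exp (- \<epsilon>))) \<le> 2 * (exp 1 * ((1 + \<Delta>) * x))"
    unfolding norm_mult by simp
  have "norm (1 - exp (2 * (\<epsilon> * of_real t))) \<le> exp (2 * x * \<bar>t\<bar>) * (2 * norm \<epsilon> * \<bar>t\<bar>)"
    using norm_exp_minus_one_le[of "2 * (\<epsilon> * of_real t)"] x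
    by (simp add: x_def norm_minus_commute norm_mult abs_mult mult_ac)
  then have two: "norm (1 - exp (2 * (\<epsilon> * of_real t))) \<le> exp (2 * x * \<bar>t\<bar>) * (2 * ((1 + \<Delta>) * x) * \<bar>t\<bar>)"
    by (rule order_trans) (use nx in \<open>intro mult_left_mono mult_right_mono; simp\<close>)
  have "x * - t \<le> x * \<bar>t\<bar>" using x by (intro mult_left_mono) auto
  then have three: "norm (exp (- (\<epsilon> * of_real t))) \<le> exp (x * \<bar>t\<bar>)"
    by (simp add: x_def norm_exp_eq_Re)
  have "norm (exp (- (\<epsilon> * of_real t)) * (1 - exp (2 * (\<epsilon> * of_real t))))
      \<le> exp (x * \<bar>t\<bar>) * (exp (2 * x * \<bar>t\<bar>) * (2 * ((1 + \<Delta>) * x) * \<bar>t\<bar>))"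
    unfolding norm_mult by (intro mult_mono two three) auto
  also have "\<dots> = exp (3 * x * \<bar>t\<bar>) * (2 * ((1 + \<Delta>) * x) * \<bar>t\<bar>)"
    by (simp add: mult_exp_exp)
  finally have "norm ((exp (- (\<epsilon> * of_real t)) * (1 - exp (2 * (\<epsilon> * of_real t))))\<^sup>2)
      \<le> (exp (3 * x * \<bar>t\<bar>) * (2 * ((1 + \<Delta>) * x) * \<bar>t\<bar>))\<^sup>2"
    unfolding norm_power by (intro power_mono) auto
  also have "\<dots> = exp (6 * x * \<bar>t\<bar>) * (4 * (1 + \<Delta>)\<^sup>2 * (x\<^sup>2 * t\<^sup>2))"
    by (simp add: power_mult_distrib flip: exp_double)
  finally have sq: "norm ((exp (- (\<epsilon> * of_real t)) * (1 - exp (2 * (\<epsilon> * of_real t))))\<^sup>2)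
      \<le> exp (6 * x * \<bar>t\<bar>) * (4 * (1 + \<Delta>)\<^sup>2 * (x\<^sup>2 * t\<^sup>2))" .
  have "norm (exp (- \<epsilon>)) \<le> 1"
    using x by (simp add: x_def norm_exp_eq_Re)
  then have sq': "norm (exp (- \<epsilon>) * (exp (- (\<epsilon> * of_real t)) * (1 - exp (2 * (\<epsilon> * of_real t))))\<^sup>2)
      \<le> exp (6 * x * \<bar>t\<bar>) * (4 * (1 + \<Delta>)\<^sup>2 * (x\<^sup>2 * t\<^sup>2))"
    unfolding norm_mult[of "exp (- \<epsilon>)"]
    by (intro order_trans[OF mult_left_le_one_le sq]) auto
  \<comment> \<open>Half of the Gaussian decay absorbs the factor \<open>exp (6 x \<bar>t\<bar>)\<close>.\<close>
  have "0 \<le> (\<bar>t\<bar> - 6)\<^sup>2" by simp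
  then have "6 * \<bar>t\<bar> \<le> t\<^sup>2 / 2 + 18"
    by (simp add: power2_diff)
  then have "x * (6 * \<bar>t\<bar>) \<le> x * (t\<^sup>2 / 2 + 18)"
    using x by (intro mult_left_mono) auto
  then have "exp (- x * t\<^sup>2) * exp (6 * x * \<bar>t\<bar>) \<le> exp (18 + - x * t\<^sup>2 / 2)"
    using x by (simp add: mult_exp_exp algebra_simps)
  then have gg: "exp (- x * t\<^sup>2) * exp (6 * x * \<bar>t\<bar>) \<le> exp 18 * exp (- x * t\<^sup>2 / 2)"
    by (simp only: exp_add)
  have "norm (2 * exp (- \<epsilon> * (of_real t)\<^sup>2) - exp (- \<epsilon> * (of_real t + 1)\<^sup>2)
           - exp (- \<epsilon> * (of_real t - 1)\<^sup>2))
      \<le> exp (- x * t\<^sup>2) * (2 * (exp 1 * ((1 + \<Delta>) * x))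
           + exp (6 * x * \<bar>t\<bar>) * (4 * (1 + \<Delta>)\<^sup>2 * (x\<^sup>2 * t\<^sup>2)))"
    unfolding gaussian_second_difference norm_mult[of "exp (- \<epsilon> * (of_real t)\<^sup>2)"] g
    by (intro mult_left_mono order_trans[OF norm_triangle_ineq4] add_mono one sq') simp
  also have "\<dots> = 2 * exp 1 * (1 + \<Delta>) * (x * exp (- x * t\<^sup>2))
        + exp (- x * t\<^sup>2) * exp (6 * x * \<bar>t\<bar>) * (4 * (1 + \<Delta>)\<^sup>2 * (x\<^sup>2 * t\<^sup>2))"
    by (simp add: algebra_simps)
  also have "\<dots> \<le> 2 * exp 1 * (1 + \<Delta>) * (x * exp (- x * t\<^sup>2))
        + exp 18 * exp (- x * t\<^sup>2 / 2) * (4 * (1 + \<Delta>)\<^sup>2 * (x\<^sup>2 * t\<^sup>2))"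
    by (intro add_left_mono mult_right_mono gg) auto
  also have "\<dots> = 2 * exp 1 * (1 + \<Delta>) * (x * exp (- x * t\<^sup>2))
        + 4 * exp 18 * (1 + \<Delta>)\<^sup>2 * (x\<^sup>2 * t\<^sup>2 * exp (- x * t\<^sup>2 / 2))"
    by (simp add: algebra_simps)
  \<comment> \<open>The constants 2 and 10 of the two weight bounds turn the coefficients 2 and 4
    into the 4 and 40 of \<open>C\<close>.\<close>
  also have "\<dots> \<le> 2 * exp 1 * (1 + \<Delta>) * (2 / (1 + t\<^sup>2))
        + 4 * exp 18 * (1 + \<Delta>)\<^sup>2 * (10 / (1 + t\<^sup>2))"
    using x \<open>\<Delta> > 0\<close>
    by (intro add_mono mult_left_mono gaussian_weight_bound gaussian_moment_bound) auto
  also have "\<dots> = C / (1 + t\<^sup>2)"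
    by (simp add: C_def add_divide_distrib)
  finally show ?thesis .
qed

section \<open>Lower bound for the denominators\<close>

text \<open>For u near 0 continuity keeps w exp u close to w, hence away from 1. For other u the
  cone forces |Re u| to be large, so |w exp u| itself stays away from 1. The cone is two-sided
  because -2n\<epsilon> occurs for both signs of n.\<close>

lemma lambert_denominator_bounded_below:
  fixes w :: complex
  assumes "norm w = 1" "w \<noteq> 1" "\<Delta> > 0"
  obtains c where "c > 0"
    "\<And>u. \<bar>Im u\<bar> \<le> \<Delta> * \<bar>Re u\<bar> \<Longrightarrow> c \<le> norm (1 - w * exp u)"
proof -
  have "isCont exp (0::complex)" by simp
  then obtain \<delta> where \<delta>: "\<delta> > 0" 
    "\<And>u::complex. norm u < \<delta> \<Longrightarrow> norm (exp u - 1) < norm (1 - w) / 2"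
    using \<open>w \<noteq> 1\<close> unfolding continuous_at_eps_delta
    by (auto simp: dist_norm dest!: spec[of _ "norm (1 - w) / 2"])
  \<comment> \<open>In the cone |u| is at most (1 + \<Delta>) |Re u|, so |u| \<ge> \<delta> forces
    |Re u| \<ge> r.\<close>
  define r where "r = \<delta> / (1 + \<Delta>)"
  have r: "r > 0" using \<delta> assms by (simp add: r_def)
  define c where "c = min (norm (1 - w) / 2) (1 - exp (- r))"
  show ?thesis
  proof (rule that[of c])
    show "c > 0" using r assms by (simp add: c_def)
    fix u :: complex assume u: "\<bar>Im u\<bar> \<le> \<Delta> * \<bar>Re u\<bar>"
    show "c \<le> norm (1 - w * exp u)"
    proof (cases "norm u < \<delta>")
      case True
      have "norm (1 - w) = norm ((1 - w * exp u) + w * (exp u - 1))"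
        by (simp add: algebra_simps)
      also have "\<dots> \<le> norm (1 - w * exp u) + norm (exp u - 1)"
        by (rule order_trans[OF norm_triangle_ineq]) (simp add: norm_mult assms)
      finally show ?thesis
        using \<delta>(2)[OF True] unfolding c_def by linarith
    next
      case False
      then have "\<delta> \<le> (1 + \<Delta>) * \<bar>Re u\<bar>"
        using cmod_le[of u] u by (simp add: algebra_simps)
      then have "r \<le> \<bar>Re u\<bar>"
        using assms by (simp add: r_def field_simps)
      then have "Re u \<ge> r \<or> Re u \<le> - r" by linarith
      \<comment> \<open>One constant serves both signs of Re u, since 1 - exp (-r) \<le> r \<le> exp
        r - 1.\<close>
      then have "1 - exp (- r) \<le> \<bar>1 - exp (Re u)\<bar>"
      proof
        assume "Re u \<ge> r"
        then have "1 + r \<le> exp (Re u)"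
          using exp_ge_add_one_self[of "Re u"] by linarith
        moreover have "1 - exp (- r) \<le> r"
          using exp_ge_add_one_self[of "- r"] by linarith
        ultimately show ?thesis by linarith
      next
        assume "Re u \<le> - r"
        then have "exp (Re u) \<le> exp (- r)" by simp
        then show ?thesis by linarith
      qed
      also have "\<dots> \<le> norm (1 - w * exp u)"
        using norm_triangle_ineq3[of 1 "w * exp u"] by (simp add: norm_mult assms)
      finally show ?thesis by (simp add: c_def)
    qed
  qed
qed

section \<open>From the Appell series to an alternating sum\<close>

definition gauss :: "complex \<Rightarrow> int \<Rightarrow> complex" where
  "gauss \<epsilon> n = exp (- \<epsilon> * (of_int n)\<^sup>2)"

definition lambert :: "complex \<Rightarrow> complex \<Rightarrow> int \<Rightarrow> complex" where
  "lambert w \<epsilon> n = 1 / (1 - w * exp (- (2 * of_int (n - 1) * \<epsilon>)))"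

lemma norm_gauss: "norm (gauss \<epsilon> n) = exp (- Re \<epsilon> * (real_of_int n)\<^sup>2)"
proof -
  have "- \<epsilon> * (of_int n)\<^sup>2 = - \<epsilon> * of_real ((real_of_int n)\<^sup>2)"
    by simp
  then show ?thesis
    unfolding gauss_def by (simp only: norm_exp_eq_Re) simp
qed

lemma appell_1_eq_alternating_sum:
  "appell 1 u (\<i> * \<epsilon> / (2 * of_real pi)) (2 * (\<i> * \<epsilon> / (2 * of_real pi))) =
     - exp (of_real pi * \<i> * u + \<epsilon>) *
       (\<Sum>\<^sub>\<infinity>n. (-1) powi n * (gauss \<epsilon> n * lambert (exp (2 * of_real pi * \<i> * u)) \<epsilon> n))"
proof -
  define \<tau> where "\<tau> = \<i> * \<epsilon> / (2 * of_real pi)"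
  have \<tau>: "2 * of_real pi * \<i> * \<tau> = - \<epsilon>"
    by (simp add: \<tau>_def)
  let ?w = "exp (2 * of_real pi * \<i> * u)"
  define T where "T n = (-1) powi n * (gauss \<epsilon> n * lambert ?w \<epsilon> n)" for n
  have "((-1) powi (int 1 * n) * exp (of_real pi * \<i> * of_nat 1 * of_int n * (of_int n + 1) * (2 * \<tau>))
           * exp (2 * of_real pi * \<i> * of_int n * \<tau>))
        / (1 - ?w * exp (2 * of_real pi * \<i> * of_int n * (2 * \<tau>))) = - exp \<epsilon> * T (n + 1)"
    for n :: int
  proof -
    have exponents:
      "of_real pi * \<i> * of_nat 1 * of_int n * (of_int n + 1) * (2 * \<tau>) = - \<epsilon> * of_int n * (of_int n + 1)"
      "2 * of_real pi * \<i> * of_int n * \<tau> = - \<epsilon> * of_int n"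
      "2 * of_real pi * \<i> * of_int n * (2 * \<tau>) = - (2 * of_int n * \<epsilon>)"
      unfolding \<tau>[symmetric] mult_minus_right[symmetric] by (simp_all add: mult_ac)
    \<comment> \<open>Completing the square: n (n + 1) + n = (n + 1)^2 - 1. Moving the index to n +
      1 also flips the sign of (-1)^n, whence the factor - exp \<epsilon>.\<close>
    have "exp (- \<epsilon> * of_int n * (of_int n + 1)) * exp (- \<epsilon> * of_int n) = exp \<epsilon> * gauss \<epsilon> (n + 1)"
    proof -
      have "- \<epsilon> * of_int n * (of_int n + 1) + - \<epsilon> * of_int n = \<epsilon> + - \<epsilon> * (of_int (n + 1))\<^sup>2"
        by (simp add: power2_eq_square algebra_simps)
      then show ?thesis
        unfolding gauss_def mult_exp_exp by (rule arg_cong)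
    qed
    then show ?thesis
      unfolding exponents mult.assoc[of "(-1) powi _" "exp _"] by (simp add: T_def lambert_def power_int_add mult.assoc)
  qed
  then have "appell 1 u \<tau> (2 * \<tau>) = exp (of_real pi * \<i> * u) * (\<Sum>\<^sub>\<infinity>n. - exp \<epsilon> * T (n + 1))"
    unfolding appell_def by simp
  \<comment> \<open>Reindexing and extracting a constant preserve \<open>infsum\<close> also where
    it takes its default value 0, so the identity holds for every \<epsilon> and u.\<close>
  also have "(\<Sum>\<^sub>\<infinity>n. - exp \<epsilon> * T (n + 1)) = (\<Sum>\<^sub>\<infinity>n. - exp \<epsilon> * T n)"
    by (rule infsum_reindex_bij_witness[of _ "\<lambda>n. n - 1" "\<lambda>n. n + 1"]) auto
  also have "\<dots> = - exp \<epsilon> * (\<Sum>\<^sub>\<infinity>n. T n)"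
    by (rule infsum_cmult_right')
  finally show ?thesis
    by (simp add: \<tau>_def T_def exp_add)
qed

text \<open>The difference of 1 / (1 - Xq) and 1 / (1 - X) is X (q - 1) / ((1 - Xq)(1 - X)). Writing
  X / (1 - X) as \<open>lambert w \<epsilon> n - 1\<close> leaves only bounded factors, although X
  itself can be exponentially large for very negative n.\<close>

lemma lambert_diff_bound:
  assumes bound: "\<And>n. norm (lambert w \<epsilon> n) \<le> K"
    and nz: "\<And>n::int. 1 - w * exp (- (2 * of_int n * \<epsilon>)) \<noteq> 0"
  shows "norm (lambert w \<epsilon> (n + 1) - lambert w \<epsilon> n) \<le> K * (1 + K) * norm (exp (- 2 * \<epsilon>) - 1)"
proof -
  define X where "X = w * exp (- (2 * of_int (n - 1) * \<epsilon>))"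
  define q where "q = exp (- 2 * \<epsilon>)"
  have "w * exp (- (2 * of_int n * \<epsilon>)) = X * q"
    by (simp add: X_def q_def mult_exp_exp algebra_simps)
  moreover have "1 - X \<noteq> 0" "1 - X * q \<noteq> 0"
    using nz[of "n - 1"] nz[of n] calculation by (simp_all add: X_def)
  ultimately have "lambert w \<epsilon> (n + 1) - lambert w \<epsilon> n =
      lambert w \<epsilon> (n + 1) * (lambert w \<epsilon> n - 1) * (q - 1)"
    unfolding lambert_def X_def[symmetric] by (simp add: divide_simps) (simp add: algebra_simps)
  moreover have "norm (lambert w \<epsilon> n - 1) \<le> 1 + K"
    using norm_triangle_ineq4[of "lambert w \<epsilon> n" 1] bound[of n] by simp
  moreover have "K \<ge> 0"
    using bound[of 0] norm_ge_zero order_trans by blast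
  ultimately show ?thesis
    using bound[of "n + 1"] by (auto simp: norm_mult q_def intro!: mult_mono)
qed

section \<open>Limit of the alternating sum\<close>

text \<open>A shift of the index by one leaves the sum of (-1)^n a(n) unchanged but flips the sign
  of (-1)^n. Adding twice the series and its two shifts therefore gives four copies of the
  sum.\<close>

lemma alternating_sum_second_difference:
  fixes a :: "int \<Rightarrow> complex"
  assumes "a summable_on UNIV"
  shows "4 * (\<Sum>\<^sub>\<infinity>n. (-1) powi n * a n) = (\<Sum>\<^sub>\<infinity>n. (-1) powi n * (2 * a n - a (n + 1) - a (n - 1)))"
proof -
  define t where "t n = (-1) powi n * a n" for n
  \<comment> \<open>For complex families unconditional summability is absolute, so the signs can be
    inserted.\<close>
  have "(\<lambda>n. norm (a n)) summable_on UNIV"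
    using assms summable_on_iff_abs_summable_on_complex by blast
  then have "(\<lambda>n. norm (t n)) summable_on UNIV"
    by (simp add: t_def norm_mult norm_power_int)
  then have t: "(t has_sum infsum t UNIV) UNIV"
    by (rule has_sum_infsum[OF abs_summable_summable])
  have "((\<lambda>n. t (n + 1)) has_sum infsum t UNIV) UNIV"
    by (rule has_sum_reindex_bij_witness[of _ "\<lambda>n. n - 1" "\<lambda>n. n + 1", THEN iffD2, rotated -1, OF t]) auto
  moreover have "((\<lambda>n. t (n - 1)) has_sum infsum t UNIV) UNIV"
    by (rule has_sum_reindex_bij_witness[of _ "\<lambda>n. n + 1" "\<lambda>n. n - 1", THEN iffD2, rotated -1, OF t]) auto
  ultimately have "((\<lambda>n. 2 * t n + t (n + 1) + t (n - 1)) has_sum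
      (2 * infsum t UNIV + infsum t UNIV + infsum t UNIV)) UNIV"
    by (intro has_sum_add has_sum_cmult_right t)
  moreover have "2 * t n + t (n + 1) + t (n - 1) = (-1) powi n * (2 * a n - a (n + 1) - a (n - 1))" for n
    by (simp add: t_def power_int_add power_int_diff algebra_simps)
  ultimately show ?thesis
    by (simp add: infsumI flip: t_def)
qed

lemma alternating_sum_tendsto_0:
  assumes w: "norm w = 1" "w \<noteq> 1" and "\<Delta> > 0"
  shows "((\<lambda>\<epsilon>. \<Sum>\<^sub>\<infinity>n. (-1) powi n * (gauss \<epsilon> n * lambert w \<epsilon> n)) \<longlongrightarrow> 0)
           (at 0 within {\<epsilon>. Re \<epsilon> > 0 \<and> \<bar>Im \<epsilon>\<bar> \<le> \<Delta> * Re \<epsilon>})" (is "(_ \<longlongrightarrow> 0) ?F")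
proof -
  obtain c where c: "c > 0" and
    c_le: "\<And>u. \<bar>Im u\<bar> \<le> \<Delta> * \<bar>Re u\<bar> \<Longrightarrow> c \<le> norm (1 - w * exp u)"
    using lambert_denominator_bounded_below[OF w \<open>\<Delta> > 0\<close>] by blast
  define K where "K = 1 / c"
  define C where "C = 4 * exp 1 * (1 + \<Delta>) + 40 * exp 18 * (1 + \<Delta>)\<^sup>2"
  define L where "L = K * (1 + K) * (exp 2 * (2 * (1 + \<Delta>)))"
  define a where "a \<epsilon> n = gauss \<epsilon> n * lambert w \<epsilon> n" for \<epsilon> n
  define D where "D n \<epsilon> = (-1) powi n * (2 * a \<epsilon> n - a \<epsilon> (n + 1) - a \<epsilon> (n - 1))" for n \<epsilon>
  define Q where "Q k n = 1 / (1 + (real_of_int (n + k))\<^sup>2)" for k n :: int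
  \<comment> \<open>The first term majorises the Gaussian second difference times
    \<open>lambert\<close>; the other two majorise the first differences of \<open>lambert\<close>
    weighted by the neighbouring Gaussians.\<close>
  define M where "M n = K * C * Q 0 n + 2 * L * Q 1 n + 2 * L * Q (- 1) n" for n
  have K: "K > 0" using c by (simp add: K_def)
  have L: "L > 0" using K \<open>\<Delta> > 0\<close> by (simp add: L_def)
  have Q: "Q k summable_on UNIV" for k
    unfolding Q_def by (rule summable_on_inverse_one_plus_square)
  have sector: "a \<epsilon> summable_on UNIV \<and> (\<forall>n. norm (D n \<epsilon>) \<le> M n)"
    if \<epsilon>: "Re \<epsilon> > 0" "\<bar>Im \<epsilon>\<bar> \<le> \<Delta> * Re \<epsilon>" "norm \<epsilon> \<le> 1" for \<epsilon>
  proof -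
    have x: "Re \<epsilon> \<le> 1"
      using \<epsilon> complex_Re_le_cmod[of \<epsilon>] by simp
    have den: "c \<le> norm (1 - w * exp (- (2 * of_int n * \<epsilon>)))" for n :: int
    proof (rule c_le)
      have "\<bar>real_of_int n\<bar> * \<bar>Im \<epsilon>\<bar> \<le> \<bar>real_of_int n\<bar> * (\<Delta> * \<bar>Re \<epsilon>\<bar>)"
        using \<epsilon> by (intro mult_left_mono) auto
      then show "\<bar>Im (- (2 * of_int n * \<epsilon>))\<bar> \<le> \<Delta> * \<bar>Re (- (2 * of_int n * \<epsilon>))\<bar>"
        by (simp add: abs_mult algebra_simps)
    qed
    have nz: "1 - w * exp (- (2 * of_int n * \<epsilon>)) \<noteq> 0" for n :: int
      using den[of n] c by auto
    have lam: "norm (lambert w \<epsilon> n) \<le> K" for n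
      using den[of "n - 1"] c by (auto simp: lambert_def norm_divide K_def intro!: frac_le)
    have gau: "Re \<epsilon> * norm (gauss \<epsilon> n) \<le> 2 * Q 0 n" for n
      using gaussian_weight_bound[OF \<epsilon>(1) x, of "of_int n"] by (simp add: norm_gauss Q_def)
    have "norm (exp (- 2 * \<epsilon>) - 1) \<le> exp (2 * Re \<epsilon>) * (2 * norm \<epsilon>)"
      using norm_exp_minus_one_le[of "- 2 * \<epsilon>"] \<epsilon> by (simp add: norm_mult abs_mult)
    also have "\<dots> \<le> exp 2 * (2 * ((1 + \<Delta>) * Re \<epsilon>))"
      using norm_le_sector[OF \<epsilon>(1,2)] x by (intro mult_mono) auto
    finally have q: "norm (exp (- 2 * \<epsilon>) - 1) \<le> exp 2 * (2 * (1 + \<Delta>)) * Re \<epsilon>"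
      by (simp add: mult_ac)
    have "norm (lambert w \<epsilon> (n + 1) - lambert w \<epsilon> n) \<le> K * (1 + K) * norm (exp (- 2 * \<epsilon>) - 1)" for n
      using lam nz by (rule lambert_diff_bound)
    also have "\<dots> \<le> K * (1 + K) * (exp 2 * (2 * (1 + \<Delta>)) * Re \<epsilon>)"
      using q K by (intro mult_left_mono) auto
    finally have diff: "norm (lambert w \<epsilon> (n + 1) - lambert w \<epsilon> n) \<le> L * Re \<epsilon>" for n
      by (simp add: L_def mult.assoc)
    \<comment> \<open>The O(Re \<epsilon>) size of the difference of \<open>lambert\<close> supplies
      exactly the factor that \<open>gau\<close> converts into a summable weight.\<close>
    have cross: "norm (gauss \<epsilon> m * (lambert w \<epsilon> m - lambert w \<epsilon> n)) \<le> 2 * L * Q 0 m"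
      if "m = n + 1 \<or> m = n - 1" for m n
    proof -
      have "norm (lambert w \<epsilon> m - lambert w \<epsilon> n) \<le> L * Re \<epsilon>"
        using that diff[of n] diff[of m] by (auto simp: norm_minus_commute)
      then have "norm (gauss \<epsilon> m * (lambert w \<epsilon> m - lambert w \<epsilon> n)) \<le> norm (gauss \<epsilon> m) * (L * Re \<epsilon>)"
        unfolding norm_mult by (intro mult_left_mono) auto
      also have "\<dots> = L * (Re \<epsilon> * norm (gauss \<epsilon> m))"
        by simp
      also have "\<dots> \<le> L * (2 * Q 0 m)"
        using L gau by (intro mult_left_mono) auto
      finally show ?thesis by simp
    qed
    have second: "norm (2 * gauss \<epsilon> n - gauss \<epsilon> (n + 1) - gauss \<epsilon> (n - 1)) \<le> C * Q 0 n" for n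
      using gaussian_second_difference_bound[OF \<epsilon> \<open>\<Delta> > 0\<close>, of "of_int n"]
      by (simp add: gauss_def Q_def C_def)
    have "norm (D n \<epsilon>) \<le> M n" for n
    proof -
      \<comment> \<open>A discrete product rule centred at n: the second difference falls on
        \<open>gauss\<close>, and \<open>lambert\<close> contributes first differences only.\<close>
      have "norm (D n \<epsilon>) = norm (lambert w \<epsilon> n * (2 * gauss \<epsilon> n - gauss \<epsilon> (n + 1) - gauss \<epsilon> (n - 1))
          - gauss \<epsilon> (n + 1) * (lambert w \<epsilon> (n + 1) - lambert w \<epsilon> n)
          - gauss \<epsilon> (n - 1) * (lambert w \<epsilon> (n - 1) - lambert w \<epsilon> n))"
        unfolding D_def a_def norm_mult[of "(-1) powi n"] by (simp add: norm_power_int algebra_simps)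
      also have "\<dots> \<le> K * (C * Q 0 n) + 2 * L * Q 0 (n + 1) + 2 * L * Q 0 (n - 1)"
      proof -
        have "norm (lambert w \<epsilon> n * (2 * gauss \<epsilon> n - gauss \<epsilon> (n + 1) - gauss \<epsilon> (n - 1))) \<le> K * (C * Q 0 n)"
          unfolding norm_mult using K by (intro mult_mono lam second) auto
        then show ?thesis
          by (intro order_trans[OF norm_triangle_ineq4 add_mono] cross disjI1 disjI2 refl)
      qed
      finally show ?thesis
        by (simp add: M_def Q_def)
    qed
    moreover have "a \<epsilon> summable_on UNIV"
    proof (rule abs_summable_summable, rule Infinite_Sum.abs_summable_on_comparison_test')
      \<comment> \<open>This majorant blows up as \<epsilon> tends to 0, which is harmless:
        summability of \<open>a\<close> is used for each fixed \<epsilon> separately.\<close>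
      show "(\<lambda>n. (2 * K / Re \<epsilon>) * Q 0 n) summable_on UNIV"
        by (intro summable_on_cmult_right Q)
      fix n
      have "norm (gauss \<epsilon> n) \<le> 2 * Q 0 n / Re \<epsilon>"
        using gau[of n] \<epsilon> by (simp add: field_simps)
      then have "norm (a \<epsilon> n) \<le> (2 * Q 0 n / Re \<epsilon>) * K"
        using lam[of n] \<epsilon> unfolding a_def norm_mult by (intro mult_mono) (auto simp: Q_def)
      then show "norm (a \<epsilon> n) \<le> (2 * K / Re \<epsilon>) * Q 0 n"
        by (simp add: mult_ac)
    qed
    ultimately show ?thesis by blast
  qed
  have ev: "\<forall>\<^sub>F \<epsilon> in ?F. Re \<epsilon> > 0 \<and> \<bar>Im \<epsilon>\<bar> \<le> \<Delta> * Re \<epsilon> \<and> norm \<epsilon> \<le> 1"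
    unfolding eventually_at by (rule exI[of _ 1]) auto
  have "((\<lambda>\<epsilon>. \<Sum>\<^sub>\<infinity>n. D n \<epsilon>) \<longlongrightarrow> 0) ?F"
  proof (rule tendsto_infsum_dominated)
    show "M summable_on UNIV"
      unfolding M_def by (intro summable_on_add summable_on_cmult_right Q)
    show "\<forall>\<^sub>F \<epsilon> in ?F. \<forall>n\<in>UNIV. norm (D n \<epsilon>) \<le> M n"
      using ev by eventually_elim (use sector in blast)
    fix n :: int
    \<comment> \<open>The limit does not depend on the index, so the coefficients 2, -1, -1 cancel
      it in every \<open>D n\<close>.\<close>
    have a: "((\<lambda>\<epsilon>. a \<epsilon> m) \<longlongrightarrow> 1 / (1 - w)) ?F" for m
    proof -
      have "((\<lambda>\<epsilon>. a \<epsilon> m) \<longlongrightarrow> exp (- 0 * (of_int m)\<^sup>2) * (1 / (1 - w * exp (- (2 * of_int (m - 1) * 0))))) ?F"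
        unfolding a_def gauss_def lambert_def using w by (intro tendsto_intros) auto
      then show ?thesis by simp
    qed
    have "(D n \<longlongrightarrow> (-1) powi n * (2 * (1 / (1 - w)) - 1 / (1 - w) - 1 / (1 - w))) ?F"
      unfolding D_def by (intro tendsto_intros a)
    then show "(D n \<longlongrightarrow> 0) ?F" by simp
  qed
  then have "((\<lambda>\<epsilon>. (\<Sum>\<^sub>\<infinity>n. D n \<epsilon>) / 4) \<longlongrightarrow> 0) ?F"
    by (rule tendsto_divide_zero)
  moreover have "\<forall>\<^sub>F \<epsilon> in ?F. (\<Sum>\<^sub>\<infinity>n. D n \<epsilon>) / 4 = (\<Sum>\<^sub>\<infinity>n. (-1) powi n * a \<epsilon> n)"
    using ev
  proof eventually_elim
    case (elim \<epsilon>)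
    then have "a \<epsilon> summable_on UNIV" using sector by blast
    from alternating_sum_second_difference[OF this, symmetric] show ?case
      by (simp add: D_def)
  qed
  ultimately show ?thesis
    unfolding a_def by (rule Lim_transform_eventually)
qed

section \<open>The Appell limits for both signs of z\<close>

theorem theorem3p1:
  fixes z \<Delta> :: real and \<tau> :: "complex \<Rightarrow> complex"
  defines "\<tau> \<equiv> \<lambda>\<epsilon>. \<i> * \<epsilon> / (2 * of_real pi)"
  assumes "0 < z" and "z < 1/2" and "\<Delta> > 0"
  shows "((\<lambda>\<epsilon>. appell 1 (of_real z) (\<tau> \<epsilon>) (2 * \<tau> \<epsilon>)) \<longlongrightarrow> 0)
           (at 0 within {\<epsilon>. Re \<epsilon> > 0 \<and> \<bar>Im \<epsilon>\<bar> \<le> \<Delta> * Re \<epsilon>})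
       \<and> ((\<lambda>\<epsilon>. appell 1 (- of_real z) (\<tau> \<epsilon>) (2 * \<tau> \<epsilon>)) \<longlongrightarrow> 0)
           (at 0 within {\<epsilon>. Re \<epsilon> > 0 \<and> \<bar>Im \<epsilon>\<bar> \<le> \<Delta> * Re \<epsilon>})"
proof -
  let ?F = "at 0 within {\<epsilon>. Re \<epsilon> > 0 \<and> \<bar>Im \<epsilon>\<bar> \<le> \<Delta> * Re \<epsilon>}"
  \<comment> \<open>A real v with 0 < |v| < 1 covers both z and -z. Such a v is not an integer, so
    \<open>w\<close> lies on the unit circle away from 1.\<close>
  have lim: "((\<lambda>\<epsilon>. appell 1 (of_real v) (\<tau> \<epsilon>) (2 * \<tau> \<epsilon>)) \<longlongrightarrow> 0) ?F" if v: "0 < \<bar>v\<bar>" "\<bar>v\<bar> < 1" for v :: real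
  proof -
    define w where "w = exp (2 * of_real pi * \<i> * of_real v)"
    have "norm w = 1"
      by (simp add: w_def norm_exp_eq_Re)
    moreover have "w \<noteq> 1"
    proof
      assume "w = 1"
      then obtain n :: int where "v = of_int n"
        by (auto simp: w_def exp_eq_1)
      with v show False
        by simp
    qed
    ultimately have "((\<lambda>\<epsilon>. \<Sum>\<^sub>\<infinity>n. (-1) powi n * (gauss \<epsilon> n * lambert w \<epsilon> n)) \<longlongrightarrow> 0) ?F"
      using \<open>\<Delta> > 0\<close> by (rule alternating_sum_tendsto_0)
    \<comment> \<open>The prefactor is continuous at \<epsilon> = 0, so it does not affect the zero
      limit.\<close>
    then have "((\<lambda>\<epsilon>. - exp (of_real pi * \<i> * of_real v + \<epsilon>)
        * (\<Sum>\<^sub>\<infinity>n. (-1) powi n * (gauss \<epsilon> n * lambert w \<epsilon> n)))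
        \<longlongrightarrow> - exp (of_real pi * \<i> * of_real v + 0) * 0) ?F"
      by (intro tendsto_intros)
    then show ?thesis
      unfolding \<tau>_def appell_1_eq_alternating_sum w_def by simp
  qed
  show ?thesis
    using lim[of z] lim[of "- z"] assms by simp
qed

end
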